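(* Let $\{\mathbf{X}_n\}_{n\ge1}$ be a stationary sequence with multivariate extremal index $\theta(\pmb{\tau})$, $\pmb{\tau}\in\mathbb{R}^d_+$. Then, for any choice $j<j'$ in $D=\{1,\ldots,d\}$: (a) $\displaystyle \chi^{H}_{jj'}=2-\theta_{jj'}\left(\frac1{\theta_j},\frac1{\theta_{j'}}\right)\Gamma_{jj'}\left(\frac1{\theta_j},\frac1{\theta_{j'}}\right)$; (b) $\displaystyle \chi^{H}_{jj'}-\chi^{\widehat H}_{jj'}=\Gamma_{jj'}(1,1)-\theta_{jj'}\left(\frac1{\theta_j},\frac1{\theta_{j'}}\right)\Gamma_{jj'}\left(\frac1{\theta_j},\frac1{\theta_{j'}}\right)$.
   Context: Setting. $\{\mathbf{X}_n=(X_{n1},\ldots,X_{nd})\}_{n\ge1}$ is a stationary sequence of random vectors whose common distribution function $F$ has continuous marginals and satisfies $F^n(nx_1,\ldots,nx_d)\to\widehat H(x_1,\ldots,x_d)$, where $\widehat H$ is a multivariate extreme value (MEV) distribution function with unit Fréchet marginals $\widehat H_j(x)=\exp(-x^{-1})$, $x>0$. With $M_{nj}=\bigvee_{i=1}^nX_{ij}$, $H$ is the MEV distribution function with $\lim_nP(M_{n1}\le nx_1,\ldots,M_{nd}\le nx_d)=H(x_1,\ldots,x_d)$. Multivariate extremal index. $\{\mathbf{X}_n\}$ has multivariate extremal index $\theta(\pmb{\tau})\in(0,1]$, $\pmb{\tau}\in\mathbb{R}^d_+$, if for each $\pmb{\tau}=(\tau_1,\ldots,\tau_d)$ there are real levels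 $\mathbf{u}_n^{(\pmb{\tau})}=(u_{n1}^{(\tau_1)},\ldots,u_{nd}^{(\tau_d)})$ with $nP(X_{1j}>u_{nj}^{(\tau_j)})\to\tau_j$ for all $j$, $P(\widehat{\mathbf{M}}_n\le\mathbf{u}_n^{(\pmb{\tau})})\to\widehat\gamma(\pmb{\tau})$ and $P(\mathbf{M}_n\le\mathbf{u}_n^{(\pmb{\tau})})\to\gamma(\pmb{\tau})=\widehat\gamma(\pmb{\tau})^{\theta(\pmb{\tau})}$, where $\mathbf{M}_n=(M_{n1},\ldots,M_{nd})$ and $\widehat{\mathbf{M}}_n$ is the vector of componentwise maxima of $n$ independent vectors with distribution function $F$. Then $H(x_1,\ldots,x_d)=\widehat H(x_1,\ldots,x_d)^{\theta(-\log\widehat H_1(x_1),\ldots,-\log\widehat H_d(x_d))}$. Any sequence of subvectors with indices in $A\subset D$ has multivariate extremal index $\theta_A(\pmb{\tau}_A)=\lim_{\tau_i\to0^+,\,i\notin A}\theta(\pmb{\tau})$; $\theta_{jj'}$ denotes $\theta_{\{j,j'\}}$, and $\theta_j=\theta_{\{j\}}\in(0,1]$ is the (constant) extremal index of $\{X_{nj}\}_{n\ge1}$. $\Gamma_{jj'}(\tau_j,\tau_{j'})=\lim_{n\to\infty}nP\big(\{X_{1j}>u_{nj}^{(\tau_j)}\}\cup\{X_{1j'}>u_{nj'}^{(\tau_{j'})}\}\big)$. Tail dependence coefficient. For a distribution function $G$ with continuous marginals $G_1,\ldots,G_d$, and $(Y_1,\ldots,Y_d)$ with distribution function $G$, $\chi^{G}_{jj'}=\lim_{u\uparrow1}P(G_j(Y_j)>u\mid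 G_{j'}(Y_{j'})>u)$. *)

theory Defs
  imports "HOL-Probability.Probability"
begin

text \<open>
  A $d$-variate distribution function is represented by the probability law on
  \<^typ>\<open>real^'d\<close> that it determines. The order on vectors is componentwise, so that
  \<open>{..x}\<close> is the lower orthant with corner \<open>x\<close>. Sequences are indexed from 1;
  the value at index 0 plays no role.
\<close>

definition prob_law :: "(real^'d) measure \<Rightarrow> bool" where
  "prob_law G \<longleftrightarrow> prob_space G \<and> sets G = sets borel"

definition mcdf :: "(real^'d) measure \<Rightarrow> real^'d \<Rightarrow> real" where
  "mcdf G x = measure G {..x}"

definition margin :: "(real^'d) measure \<Rightarrow> 'd \<Rightarrow> real measure" where
  "margin G j = distr G borel (\<lambda>y. y $ j)"

text \<open>
  Multivariate extreme value laws: the laws with non-degenerate margins that arise as weak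
  limits of affinely normalized componentwise maxima of independent, identically distributed
  vectors.
\<close>

definition mev :: "(real^'d) measure \<Rightarrow> bool" where
  "mev H \<longleftrightarrow> prob_law H \<and> (\<forall>j c. margin H j \<noteq> return borel c) \<and>
     (\<exists>G a b. prob_law G \<and> (\<forall>n j. 0 < a n $ j) \<and>
        (\<forall>x. isCont (mcdf H) x \<longrightarrow>
           (\<lambda>n. mcdf G (\<chi> j. a n $ j * x $ j + b n $ j) ^ n) \<longlonglongrightarrow> mcdf H x))"

definition unit_frechet_margins :: "(real^'d) measure \<Rightarrow> bool" where
  "unit_frechet_margins H \<longleftrightarrow> (\<forall>j. \<forall>x>0. cdf (margin H j) x = exp (- (1 / x)))"

definition stationary :: "'a measure \<Rightarrow> (nat \<Rightarrow> 'a \<Rightarrow> real^'d) \<Rightarrow> bool" where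
  "stationary M X \<longleftrightarrow> (\<forall>i\<ge>1. X i \<in> borel_measurable M) \<and>
     (\<forall>m h. distr M (PiM {1..m} (\<lambda>_. borel)) (\<lambda>\<omega>. \<lambda>i\<in>{1..m}. X (i + h) \<omega>) =
            distr M (PiM {1..m} (\<lambda>_. borel)) (\<lambda>\<omega>. \<lambda>i\<in>{1..m}. X i \<omega>))"

definition cmax :: "nat \<Rightarrow> (nat \<Rightarrow> real^'d) \<Rightarrow> real^'d" where
  "cmax n x = (\<chi> j. Max ((\<lambda>i. x i $ j) ` {1..n}))"

definition max_prob :: "'a measure \<Rightarrow> (nat \<Rightarrow> 'a \<Rightarrow> real^'d) \<Rightarrow> nat \<Rightarrow> real^'d \<Rightarrow> real" where
  "max_prob M X n x = \<P>(\<omega> in M. cmax n (\<lambda>i. X i \<omega>) \<le> x)"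

text \<open>The same probability for \<open>n\<close> independent vectors with common law \<open>G\<close>.\<close>

definition iid_max_prob :: "(real^'d) measure \<Rightarrow> nat \<Rightarrow> real^'d \<Rightarrow> real" where
  "iid_max_prob G n x = \<P>(y in PiM {1..n} (\<lambda>_. G). cmax n y \<le> x)"

text \<open>
  The level for coordinate \<open>j\<close> depends on \<open>\<tau>\<close> through \<open>\<tau> $ j\<close> only; this is what makes
  bivariate quantities such as \<open>exceed_lim\<close> below functions of two arguments.
\<close>

definition has_multivariate_extremal_index ::
  "'a measure \<Rightarrow> (nat \<Rightarrow> 'a \<Rightarrow> real^'d) \<Rightarrow> (nat \<Rightarrow> 'd \<Rightarrow> real \<Rightarrow> real) \<Rightarrow> (real^'d \<Rightarrow> real) \<Rightarrow> bool" where
  "has_multivariate_extremal_index M X u \<theta> \<longleftrightarrow>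
     (\<forall>\<tau>. (\<forall>j. 0 < \<tau> $ j) \<longrightarrow>
        0 < \<theta> \<tau> \<and> \<theta> \<tau> \<le> 1 \<and>
        (\<forall>j. (\<lambda>n. real n * \<P>(\<omega> in M. X 1 \<omega> $ j > u n j (\<tau> $ j))) \<longlonglongrightarrow> \<tau> $ j) \<and>
        (\<exists>g. (\<lambda>n. iid_max_prob (distr M borel (X 1)) n (\<chi> j. u n j (\<tau> $ j))) \<longlonglongrightarrow> g \<and>
             (\<lambda>n. max_prob M X n (\<chi> j. u n j (\<tau> $ j))) \<longlonglongrightarrow> g powr \<theta> \<tau>))"

definition has_extremal_index :: "'a measure \<Rightarrow> (nat \<Rightarrow> 'a \<Rightarrow> real) \<Rightarrow> real \<Rightarrow> bool" where
  "has_extremal_index M Y \<theta> \<longleftrightarrow> 0 < \<theta> \<and> \<theta> \<le> 1 \<and>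
     (\<forall>\<tau>>0. \<exists>v. (\<lambda>n. real n * \<P>(\<omega> in M. Y 1 \<omega> > v n)) \<longlonglongrightarrow> \<tau> \<and>
        (\<lambda>n. \<P>(\<omega> in M. Max ((\<lambda>i. Y i \<omega>) ` {1..n}) \<le> v n)) \<longlonglongrightarrow> exp (- (\<theta> * \<tau>)))"

text \<open>
  The index of a subvector: the coordinates outside \<open>A\<close> tend jointly to 0 from above. Only the
  coordinates of \<open>\<tau>\<close> in \<open>A\<close> matter.
\<close>

definition sub_index :: "(real^'d \<Rightarrow> real) \<Rightarrow> 'd set \<Rightarrow> real^'d \<Rightarrow> real" where
  "sub_index \<theta> A \<tau> =
     Lim (at 0 within {s. \<forall>i. 0 < s $ i}) (\<lambda>s. \<theta> (\<chi> i. if i \<in> A then \<tau> $ i else s $ i))"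

definition pair_index :: "(real^'d \<Rightarrow> real) \<Rightarrow> 'd \<Rightarrow> 'd \<Rightarrow> real \<Rightarrow> real \<Rightarrow> real" where
  "pair_index \<theta> j j' s t = sub_index \<theta> {j, j'} (\<chi> i. if i = j then s else t)"

definition exceed_lim ::
  "'a measure \<Rightarrow> (nat \<Rightarrow> 'a \<Rightarrow> real^'d) \<Rightarrow> (nat \<Rightarrow> 'd \<Rightarrow> real \<Rightarrow> real) \<Rightarrow>
     'd \<Rightarrow> 'd \<Rightarrow> real \<Rightarrow> real \<Rightarrow> real" where
  "exceed_lim M X u j j' s t =
     lim (\<lambda>n. real n * \<P>(\<omega> in M. X 1 \<omega> $ j > u n j s \<or> X 1 \<omega> $ j' > u n j' t))"

definition tail_prob :: "(real^'d) measure \<Rightarrow> 'd \<Rightarrow> 'd \<Rightarrow> real \<Rightarrow> real" where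
  "tail_prob G j j' v =
     \<P>(y in G. cdf (margin G j) (y $ j) > v \<bar> cdf (margin G j') (y $ j') > v)"

definition tail_dep :: "(real^'d) measure \<Rightarrow> 'd \<Rightarrow> 'd \<Rightarrow> real" where
  "tail_dep G j j' = Lim (at_left 1) (tail_prob G j j')"

end

theory Submission
  imports Defs
begin

text \<open>
  Write \<open>1 / x\<close> for the componentwise reciprocal. The levels \<open>u n i (\<tau> $ i)\<close> and
  \<open>n / \<tau> $ i\<close> have the same marginal exceedance rate \<open>\<tau> $ i\<close>, and exchanging levels costs at
  most \<open>n\<close> times the sum of the differences of the marginal distribution functions. Hence the
  definition of the extremal index gives \<open>H (1 / \<tau>) = Hhat (1 / \<tau>) powr \<theta> \<tau>\<close>. Sending the
  coordinates outside \<open>A\<close> to infinity turns \<open>\<theta>\<close> into the quotient of the logarithms of the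
  \<open>A\<close>-margins of \<open>H\<close> and \<open>Hhat\<close>, while the limit of the joint exceedance rates is minus
  the denominator, so their product is minus the logarithm of the margin of \<open>H\<close>. The margins
  of \<open>H\<close> are therefore \<open>exp (- \<theta>\<^sub>1 i / s)\<close>. By max-stability \<open>H\<close> restricted to two
  coordinates along the ray through \<open>\<theta>\<^sub>1\<close> is \<open>v powr L\<close> at the marginal level \<open>v\<close>, where \<open>L\<close> is minus
  its logarithm at \<open>\<theta>\<^sub>1\<close>, and the tail dependence coefficient is \<open>2 - L\<close>.
\<close>

section \<open>Distribution functions of subvectors\<close>

text \<open>Keeping \<open>x\<close> a full vector and ignoring its coordinates outside
  \<open>A\<close> lets subvectors of every dimension share one type. \<open>A = UNIV\<close> gives
  \<open>mcdf\<close>, a singleton gives a margin, and \<open>A = {}\<close> gives the total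
  mass.\<close>

definition sub_mcdf :: "(real^'d) measure \<Rightarrow> 'd set \<Rightarrow> real^'d \<Rightarrow> real" where
  "sub_mcdf G A x = measure G {y. \<forall>i\<in>A. y $ i \<le> x $ i}"

lemma sub_mcdf_UNIV: "sub_mcdf G UNIV x = mcdf G x"
proof -
  have "{..x} = {y. \<forall>i\<in>UNIV. y $ i \<le> x $ i}"
    by (auto simp: less_eq_vec_def)
  then show ?thesis
    by (simp add: sub_mcdf_def mcdf_def)
qed

lemma prob_law_prob_space: "prob_law G \<Longrightarrow> prob_space G"
  by (simp add: prob_law_def)

lemma prob_law_sets: "prob_law G \<Longrightarrow> sets G = sets borel"
  by (simp add: prob_law_def)

lemma prob_law_space: "prob_law G \<Longrightarrow> space G = UNIV"
  by (metis prob_law_sets sets_eq_imp_space_eq space_borel)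

lemma orthant_borel: "{y :: real^'d. \<forall>i\<in>A. y $ i \<le> x $ i} \<in> sets borel"
proof -
  have "{y :: real^'d. \<forall>i\<in>A. y $ i \<le> x $ i} = (\<Inter>i\<in>A. {y. y $ i \<le> x $ i})"
    by auto
  moreover have "closed (\<Inter>i\<in>A. {y :: real^'d. y $ i \<le> x $ i})"
    by (intro closed_INT ballI closed_Collect_le continuous_intros)
  ultimately have "closed {y :: real^'d. \<forall>i\<in>A. y $ i \<le> x $ i}"
    by simp
  then show ?thesis by simp
qed

lemma orthant_sets: "prob_law G \<Longrightarrow> {y. \<forall>i\<in>A. y $ i \<le> x $ i} \<in> sets G"
  by (simp add: prob_law_sets orthant_borel)

lemma cdf_margin:
  assumes "prob_law G"
  shows "cdf (margin G i) x = sub_mcdf G {i} (\<chi> _. x)"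
proof -
  have "(\<lambda>y::real^'a. y $ i) \<in> borel_measurable G"
    using prob_law_sets[OF assms] by (simp cong: measurable_cong_sets)
  then have "cdf (margin G i) x = measure G ((\<lambda>y. y $ i) -` {..x} \<inter> space G)"
    by (simp add: cdf_def margin_def measure_distr)
  also have "(\<lambda>y. y $ i) -` {..x} \<inter> space G = {y. \<forall>i\<in>{i}. y $ i \<le> (\<chi> _. x) $ i}"
    using prob_law_space[OF assms] by auto
  finally show ?thesis
    by (simp add: sub_mcdf_def)
qed

lemma sub_mcdf_le_1: "prob_law G \<Longrightarrow> sub_mcdf G A x \<le> 1"
  by (simp add: sub_mcdf_def prob_law_prob_space prob_space.prob_le_1)

lemma sub_mcdf_nonneg: "0 \<le> sub_mcdf G A x"
  by (simp add: sub_mcdf_def)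

lemma sub_mcdf_mono:
  assumes "prob_law G" "B \<subseteq> A" "\<And>i. i \<in> B \<Longrightarrow> x $ i \<le> y $ i"
  shows "sub_mcdf G A x \<le> sub_mcdf G B y"
proof -
  interpret prob_space G using assms(1) by (rule prob_law_prob_space)
  show ?thesis
    unfolding sub_mcdf_def
  proof (rule finite_measure_mono)
    show "{z. \<forall>i\<in>A. z $ i \<le> x $ i} \<subseteq> {z. \<forall>i\<in>B. z $ i \<le> y $ i}"
      using assms(2,3) by (blast intro: order_trans)
  qed (rule orthant_sets[OF assms(1)])
qed

lemma sub_mcdf_cong: "(\<And>i. i \<in> A \<Longrightarrow> x $ i = y $ i) \<Longrightarrow> sub_mcdf G A x = sub_mcdf G A y"
  by (simp add: sub_mcdf_def)

text \<open>If the constraints hold with \<open>a\<close> but fail with \<open>b\<close>, some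
  \<open>Y i\<close> lies between \<open>b i\<close> and \<open>a i\<close>. A union bound over
  these gaps gives one direction, symmetry the other. The dependence among the \<open>Y i\<close> is
  arbitrary, so the bound serves the coordinates of one vector as well as a whole stretch of a
  stationary sequence.\<close>

lemma (in prob_space) prob_all_le_diff:
  fixes Y :: "'i \<Rightarrow> 'a \<Rightarrow> real"
  assumes "finite I" and Y: "\<And>i. i \<in> I \<Longrightarrow> Y i \<in> borel_measurable M"
  shows "\<bar>\<P>(\<omega> in M. \<forall>i\<in>I. Y i \<omega> \<le> a i) - \<P>(\<omega> in M. \<forall>i\<in>I. Y i \<omega> \<le> b i)\<bar>
    \<le> (\<Sum>i\<in>I. \<bar>\<P>(\<omega> in M. Y i \<omega> \<le> a i) - \<P>(\<omega> in M. Y i \<omega> \<le> b i)\<bar>)"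
proof -
  have one_sided: "\<P>(\<omega> in M. \<forall>i\<in>I. Y i \<omega> \<le> a i) - \<P>(\<omega> in M. \<forall>i\<in>I. Y i \<omega> \<le> b i)
    \<le> (\<Sum>i\<in>I. \<bar>\<P>(\<omega> in M. Y i \<omega> \<le> a i) - \<P>(\<omega> in M. Y i \<omega> \<le> b i)\<bar>)" for a b :: "'i \<Rightarrow> real"
  proof -
    define L where "L c i = {\<omega>\<in>space M. Y i \<omega> \<le> c i}" for c :: "'i \<Rightarrow> real" and i
    define A where "A c = {\<omega>\<in>space M. \<forall>i\<in>I. Y i \<omega> \<le> c i}" for c :: "'i \<Rightarrow> real"
    have L: "L c i \<in> events" if "i \<in> I" for c i
      using Y[OF that] unfolding L_def by measurable
    have "A c = space M \<inter> (\<Inter>i\<in>I. L c i)" for c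
      by (auto simp: A_def L_def)
    then have A: "A c \<in> events" for c
      using L \<open>finite I\<close> by (cases "I = {}") (auto intro!: sets.Int sets.finite_INT)
    have "prob (A a) \<le> prob (A b \<union> (\<Union>i\<in>I. L a i - L b i))"
      using A L \<open>finite I\<close> by (intro finite_measure_mono sets.Un sets.finite_UN) (auto simp: A_def L_def)
    also have "\<dots> \<le> prob (A b) + prob (\<Union>i\<in>I. L a i - L b i)"
      using A L \<open>finite I\<close> by (intro measure_Un_le sets.finite_UN) auto
    also have "prob (\<Union>i\<in>I. L a i - L b i) \<le> (\<Sum>i\<in>I. prob (L a i - L b i))"
      using L \<open>finite I\<close> by (intro finite_measure_subadditive_finite) auto
    also have "\<dots> \<le> (\<Sum>i\<in>I. \<bar>prob (L a i) - prob (L b i)\<bar>)"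
    proof (rule sum_mono)
      fix i assume i: "i \<in> I"
      \<comment> \<open>The two half-line events are nested, so their set difference is either empty
        or has the difference of the probabilities as its measure.\<close>
      show "prob (L a i - L b i) \<le> \<bar>prob (L a i) - prob (L b i)\<bar>"
      proof (cases "a i \<le> b i")
        case True
        then have "L a i - L b i = {}" by (auto simp: L_def)
        then show ?thesis by (simp only: measure_empty abs_ge_zero)
      next
        case False
        then have "L b i \<subseteq> L a i" by (auto simp: L_def)
        then show ?thesis using L[OF i] by (simp add: finite_measure_Diff)
      qed
    qed
    finally show ?thesis
      by (simp add: A_def L_def)
  qed
  from one_sided[of a b] one_sided[of b a] show ?thesis
    by (simp add: abs_minus_commute abs_le_iff)
qed

text \<open>Controls a joint distribution function by its margins. Both the exchange of levels and
  the continuity of \<open>mcdf\<close> rest on this bound.\<close>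

lemma sub_mcdf_diff_le:
  fixes G :: "(real^'d) measure"
  assumes "prob_law G"
  shows "\<bar>sub_mcdf G A x - sub_mcdf G A y\<bar> \<le> (\<Sum>i\<in>A. \<bar>sub_mcdf G {i} x - sub_mcdf G {i} y\<bar>)"
proof -
  interpret prob_space G using assms by (rule prob_law_prob_space)
  have "(\<lambda>y. y $ i) \<in> borel_measurable G" for i
    using prob_law_sets[OF assms] by (simp cong: measurable_cong_sets)
  from prob_all_le_diff[of A "\<lambda>i y. y $ i" "vec_nth x" "vec_nth y", OF _ this] show ?thesis
    by (simp add: sub_mcdf_def prob_law_space[OF assms])
qed

section \<open>Exceedance rates and their limits\<close>

text \<open>Both implications rest on \<open>1 - p \<le> - ln p \<le> (1 - p) / p\<close>.\<close>

lemma power_seq_tendsto_iff: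
  fixes p :: "nat \<Rightarrow> real"
  assumes p: "\<And>n. 0 \<le> p n" "\<And>n. p n \<le> 1" and "0 < g"
  shows "(\<lambda>n. p n ^ n) \<longlonglongrightarrow> g \<longleftrightarrow> (\<lambda>n. real n * (1 - p n)) \<longlonglongrightarrow> - ln g"
proof -
  have ln_bounds: "1 - q \<le> - ln q" "- ln q \<le> (1 - q) / q" if "0 < q" for q :: real
    using ln_le_minus_one[OF that] ln_le_minus_one[of "1 / q"] that
    by (auto simp: ln_div diff_divide_distrib)
  \<comment> \<open>Dividing a convergent sequence by \<open>n\<close> gives a null sequence, here
    \<open>1 - p n\<close>.\<close>
  have to_1: "p \<longlonglongrightarrow> 1" if "(\<lambda>n. real n * (1 - p n)) \<longlonglongrightarrow> L" for L
  proof -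
    have "(\<lambda>n. 1 - real n * (1 - p n) * (1 / real n)) \<longlonglongrightarrow> 1 - L * 0"
      by (intro tendsto_intros that lim_1_over_n)
    then have "(\<lambda>n. 1 - real n * (1 - p n) * (1 / real n)) \<longlonglongrightarrow> 1"
      by simp
    then show ?thesis
      by (rule Lim_transform_eventually) (rule eventually_sequentiallyI[of 1], simp)
  qed
  show ?thesis
  proof
    assume lim: "(\<lambda>n. p n ^ n) \<longlonglongrightarrow> g"
    \<comment> \<open>The index 0 has to be excluded, because \<open>0 ^ 0 = 1\<close> does not
      reveal that \<open>p 0 = 0\<close>.\<close>
    have pos: "\<forall>\<^sub>F n in sequentially. 0 < p n"
      using order_tendstoD(1)[OF lim \<open>0 < g\<close>] eventually_gt_at_top[of 0]
    proof eventually_elim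
      case (elim n)
      then show ?case using p(1)[of n] by (cases "p n = 0") (auto simp: zero_power)
    qed
    have "(\<lambda>n. ln (p n ^ n)) \<longlonglongrightarrow> ln g"
      using lim \<open>0 < g\<close> by (intro tendsto_intros) auto
    then have ln_lim: "(\<lambda>n. - (real n * ln (p n))) \<longlonglongrightarrow> - ln g"
      by (intro tendsto_minus) (elim Lim_transform_eventually, use pos in eventually_elim, simp add: ln_realpow)
    have "(\<lambda>n. - (- (real n * ln (p n)) * (1 / real n))) \<longlonglongrightarrow> - (- ln g * 0)"
      by (intro tendsto_intros ln_lim lim_1_over_n)
    then have "(\<lambda>n. ln (p n)) \<longlonglongrightarrow> 0"
      by (simp, elim Lim_transform_eventually) (rule eventually_sequentiallyI[of 1], simp)
    then have "(\<lambda>n. exp (ln (p n))) \<longlonglongrightarrow> exp 0"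
      by (rule tendsto_exp)
    then have "p \<longlonglongrightarrow> 1"
      by (simp, elim Lim_transform_eventually) (use pos in eventually_elim, simp)
    then have "(\<lambda>n. p n * - (real n * ln (p n))) \<longlonglongrightarrow> 1 * - ln g"
      using ln_lim by (rule tendsto_mult)
    then have low: "(\<lambda>n. p n * - (real n * ln (p n))) \<longlonglongrightarrow> - ln g"
      by simp
    show "(\<lambda>n. real n * (1 - p n)) \<longlonglongrightarrow> - ln g"
    proof (rule tendsto_sandwich[OF _ _ low ln_lim])
      show "\<forall>\<^sub>F n in sequentially. p n * - (real n * ln (p n)) \<le> real n * (1 - p n)"
        using pos
      proof eventually_elim
        case (elim n)
        have "p n * - ln (p n) \<le> 1 - p n"
          using ln_bounds(2)[OF elim] elim by (simp add: field_simps)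
        from mult_left_mono[OF this, of "real n"] show ?case
          by (simp add: algebra_simps)
      qed
      show "\<forall>\<^sub>F n in sequentially. real n * (1 - p n) \<le> - (real n * ln (p n))"
        using pos
      proof eventually_elim
        case (elim n)
        from mult_left_mono[OF ln_bounds(1)[OF elim], of "real n"] show ?case
          by simp
      qed
    qed
  next
    assume lim: "(\<lambda>n. real n * (1 - p n)) \<longlonglongrightarrow> - ln g"
    have one: "p \<longlonglongrightarrow> 1" by (rule to_1[OF lim])
    have pos: "\<forall>\<^sub>F n in sequentially. 0 < p n"
      using order_tendstoD(1)[OF one, of 0] by simp
    have "(\<lambda>n. real n * (1 - p n) / p n) \<longlonglongrightarrow> - ln g / 1"
      using lim one by (intro tendsto_intros) auto
    then have up: "(\<lambda>n. real n * (1 - p n) / p n) \<longlonglongrightarrow> - ln g" by simp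
    have "(\<lambda>n. - (real n * ln (p n))) \<longlonglongrightarrow> - ln g"
    proof (rule tendsto_sandwich[OF _ _ lim up])
      show "\<forall>\<^sub>F n in sequentially. real n * (1 - p n) \<le> - (real n * ln (p n))"
        using pos
      proof eventually_elim
        case (elim n)
        from mult_left_mono[OF ln_bounds(1)[OF elim], of "real n"] show ?case
          by simp
      qed
      show "\<forall>\<^sub>F n in sequentially. - (real n * ln (p n)) \<le> real n * (1 - p n) / p n"
        using pos
      proof eventually_elim
        case (elim n)
        from mult_left_mono[OF ln_bounds(2)[OF elim], of "real n"] show ?case
          by simp
      qed
    qed
    then have "(\<lambda>n. exp (real n * ln (p n))) \<longlonglongrightarrow> exp (ln g)"
      by (intro tendsto_exp) (simp add: tendsto_minus_cancel_left)
    then have "(\<lambda>n. exp (real n * ln (p n))) \<longlonglongrightarrow> g"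
      using \<open>0 < g\<close> by simp
    then show "(\<lambda>n. p n ^ n) \<longlonglongrightarrow> g"
      by (rule Lim_transform_eventually) (use pos in eventually_elim, simp add: exp_of_nat_mult)
  qed
qed

text \<open>The orthants with corners on the diagonal at integer points increase to the whole space.
  Monotonicity carries the limit from integers to reals.\<close>

lemma mcdf_diagonal_tendsto:
  fixes G :: "(real^'d) measure"
  assumes "prob_law G"
  shows "((\<lambda>K. mcdf G (\<chi> _. K)) \<longlongrightarrow> 1) at_top"
proof (rule tendsto_at_topI_sequentially_real)
  interpret prob_space G using assms by (rule prob_law_prob_space)
  show "mono (\<lambda>K. mcdf G (\<chi> _. K))"
    by (auto simp: sub_mcdf_UNIV[symmetric] intro!: monoI sub_mcdf_mono assms)
  let ?B = "\<lambda>n. {y :: real^'d. \<forall>i\<in>UNIV. y $ i \<le> (\<chi> _. real n) $ i}"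
  have "\<exists>n. y \<in> ?B n" for y
  proof -
    obtain n where "infnorm y \<le> real n" using real_arch_simple by blast
    then have "\<forall>i. y $ i \<le> real n"
      using component_le_infnorm_cart[of y] by (meson abs_le_D1 order_trans)
    then show ?thesis by auto
  qed
  then have "(\<Union>n. ?B n) = space G"
    by (auto simp: prob_law_space[OF assms])
  moreover have "(\<lambda>n. measure G (?B n)) \<longlonglongrightarrow> measure G (\<Union>n. ?B n)"
    by (intro finite_Lim_measure_incseq image_subsetI orthant_sets[OF assms]) (auto simp: incseq_def intro: order_trans)
  ultimately have "(\<lambda>n. measure G (?B n)) \<longlonglongrightarrow> 1"
    by (simp add: prob_space)
  then show "(\<lambda>n. mcdf G (\<chi> _. real n)) \<longlonglongrightarrow> 1"
    by (simp add: sub_mcdf_UNIV[symmetric] sub_mcdf_def)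
qed

text \<open>A point that satisfies the constraints in \<open>A\<close> and lies below
  \<open>z\<close> also lies below \<open>w\<close>. The error term depends on \<open>z\<close>
  alone, so it stays the same while \<open>w\<close> moves further out.\<close>

lemma sub_mcdf_le_mcdf_plus:
  fixes G :: "(real^'d) measure"
  assumes "prob_law G" and w: "\<And>i. i \<in> A \<Longrightarrow> w $ i = x $ i" "\<And>i. i \<notin> A \<Longrightarrow> z $ i \<le> w $ i"
  shows "sub_mcdf G A x \<le> mcdf G w + (1 - mcdf G z)"
proof -
  interpret prob_space G using assms(1) by (rule prob_law_prob_space)
  let ?O = "\<lambda>A x. {y :: real^'d. \<forall>i\<in>A. y $ i \<le> x $ i}"
  note sets = orthant_sets[OF assms(1)]
  have "y \<in> ?O UNIV w" if y: "y \<in> ?O A x" "y \<in> ?O UNIV z" for y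
  proof -
    have "y $ i \<le> w $ i" for i
      using y w[of i] by (cases "i \<in> A") (auto intro: order_trans)
    then show ?thesis by simp
  qed
  then have "prob (?O A x) \<le> prob (?O UNIV w \<union> (space G - ?O UNIV z))"
    using prob_law_space[OF assms(1)] by (intro finite_measure_mono sets.Un sets.compl_sets sets) blast
  also have "\<dots> \<le> prob (?O UNIV w) + prob (space G - ?O UNIV z)"
    by (intro measure_Un_le sets.compl_sets sets)
  also have "prob (space G - ?O UNIV z) = 1 - prob (?O UNIV z)"
    by (rule prob_compl[OF sets])
  finally show ?thesis
    by (simp add: sub_mcdf_UNIV[symmetric] sub_mcdf_def)
qed

text \<open>Monotonicity bounds the values from above; \<open>sub_mcdf_le_mcdf_plus\<close> with
  \<open>z\<close> far out on the diagonal bounds them from below. The filter is left general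
  because the limit is taken over reals and integers tending to infinity and over vectors tending to
  0.\<close>

lemma sub_mcdf_limit:
  fixes G :: "(real^'d) measure"
  assumes G: "prob_law G" and wA: "\<And>s i. i \<in> A \<Longrightarrow> w s $ i = x $ i"
    and w: "\<And>i. i \<notin> A \<Longrightarrow> filterlim (\<lambda>s. w s $ i) at_top F"
  shows "((\<lambda>s. mcdf G (w s)) \<longlongrightarrow> sub_mcdf G A x) F"
proof (rule order_tendstoI)
  fix a assume "sub_mcdf G A x < a"
  moreover have "mcdf G (w s) \<le> sub_mcdf G A x" for s
    unfolding sub_mcdf_UNIV[symmetric] by (rule sub_mcdf_mono[OF G]) (auto simp: wA)
  ultimately show "\<forall>\<^sub>F s in F. mcdf G (w s) < a"
    by (intro always_eventually allI) (meson le_less_trans)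
next
  fix a assume "a < sub_mcdf G A x"
  then have "\<forall>\<^sub>F K in at_top. 1 - (sub_mcdf G A x - a) < mcdf G (\<chi> _. K)"
    by (intro order_tendstoD(1)[OF mcdf_diagonal_tendsto[OF G]]) simp
  then obtain K where K: "1 - (sub_mcdf G A x - a) < mcdf G (\<chi> _. K)"
    using eventually_happens by force
  have "\<forall>\<^sub>F s in F. \<forall>i\<in>-A. K \<le> w s $ i"
    using w by (intro eventually_ball_finite) (auto simp: filterlim_at_top)
  then show "\<forall>\<^sub>F s in F. a < mcdf G (w s)"
  proof eventually_elim
    case (elim s)
    then have "sub_mcdf G A x \<le> mcdf G (w s) + (1 - mcdf G (\<chi> _. K))"
      by (intro sub_mcdf_le_mcdf_plus G wA) auto
    with K show ?case by simp
  qed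
qed

lemma sub_mcdf_pos:
  assumes "prob_law H" "0 < mcdf H x"
  shows "0 < sub_mcdf H A x"
  using assms sub_mcdf_mono[of H A UNIV x x] by (simp add: sub_mcdf_UNIV)

text \<open>Interchanges \<open>n\<close> tending to infinity with the coordinates outside
  \<open>A\<close> tending to infinity. With \<open>w K\<close> equal to \<open>x\<close> on
  \<open>A\<close> and to \<open>K\<close> elsewhere, the rate for \<open>A\<close> lies below the
  full rate at \<open>w K\<close>, and above that rate minus the full rate at the diagonal point
  \<open>z K\<close>. The monotone levels \<open>U\<close> cover affine norming as well as the
  levels \<open>n * s\<close>.\<close>

lemma sub_mcdf_exceedance_limit:
  fixes G H :: "(real^'d) measure" and U :: "nat \<Rightarrow> 'd \<Rightarrow> real \<Rightarrow> real"
  assumes G: "prob_law G" and H: "prob_law H" and U: "\<And>n i. mono (U n i)"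
    and lim: "\<And>x. (\<forall>i. 0 < x $ i) \<Longrightarrow> (\<lambda>n. mcdf G (\<chi> i. U n i (x $ i)) ^ n) \<longlonglongrightarrow> mcdf H x"
    and pos: "\<And>x. (\<forall>i. 0 < x $ i) \<Longrightarrow> 0 < mcdf H x"
    and x: "\<forall>i. 0 < x $ i"
  shows "(\<lambda>n. real n * (1 - sub_mcdf G A (\<chi> i. U n i (x $ i)))) \<longlonglongrightarrow> - ln (sub_mcdf H A x)"
proof -
  define V where "V n w = (\<chi> i. U n i (w $ i))" for n and w :: "real^'d"
  define w where "w K = (\<chi> i. if i \<in> A then x $ i else K)" for K
  define z where "z K = (\<chi> (_::'d). K)" for K :: real
  have full: "(\<lambda>n. real n * (1 - mcdf G (V n y))) \<longlonglongrightarrow> - ln (mcdf H y)" if "\<forall>i. 0 < y $ i" for y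
    using lim[OF that] pos[OF that] sub_mcdf_nonneg[of G UNIV] sub_mcdf_le_1[OF G, of UNIV]
    by (subst power_seq_tendsto_iff[symmetric]) (auto simp: V_def sub_mcdf_UNIV)
  have wz: "\<forall>i. 0 < w K $ i" "\<forall>i. 0 < z K $ i" if "0 < K" for K
    using that x by (auto simp: w_def z_def)
  have up: "real n * (1 - sub_mcdf G A (V n x)) \<le> real n * (1 - mcdf G (V n (w K)))" for n K
  proof -
    have "mcdf G (V n (w K)) \<le> sub_mcdf G A (V n x)"
      unfolding sub_mcdf_UNIV[symmetric] by (rule sub_mcdf_mono[OF G]) (auto simp: V_def w_def)
    then show ?thesis by (intro mult_left_mono) auto
  qed
  have low: "real n * (1 - mcdf G (V n (w K))) - real n * (1 - mcdf G (V n (z K)))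
      \<le> real n * (1 - sub_mcdf G A (V n x))" for n K
  proof -
    have "sub_mcdf G A (V n x) \<le> mcdf G (V n (w K)) + (1 - mcdf G (V n (z K)))"
      by (rule sub_mcdf_le_mcdf_plus[OF G]) (auto simp: V_def w_def z_def)
    from mult_left_mono[OF this, of "real n"] show ?thesis
      by (simp add: algebra_simps)
  qed
  have Hw: "((\<lambda>K. - ln (mcdf H (w K))) \<longlongrightarrow> - ln (sub_mcdf H A x)) at_top"
    using sub_mcdf_pos[OF H pos[OF x], of A]
    by (intro tendsto_intros sub_mcdf_limit[OF H]) (auto simp: w_def filterlim_ident)
  \<comment> \<open>The limiting error at \<open>z K\<close> vanishes as \<open>K\<close> grows, so
    the lower and upper bounds share their limit.\<close>
  have "((\<lambda>K. - ln (mcdf H (z K))) \<longlongrightarrow> - ln 1) at_top"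
    unfolding z_def by (intro tendsto_intros mcdf_diagonal_tendsto[OF H]) auto
  from tendsto_diff[OF Hw this]
  have Hwz: "((\<lambda>K. - ln (mcdf H (w K)) - - ln (mcdf H (z K))) \<longlongrightarrow> - ln (sub_mcdf H A x)) at_top"
    by simp
  have "(\<lambda>n. real n * (1 - sub_mcdf G A (V n x))) \<longlonglongrightarrow> - ln (sub_mcdf H A x)"
  proof (rule order_tendstoI)
    fix a assume "a < - ln (sub_mcdf H A x)"
    from eventually_conj[OF order_tendstoD(1)[OF Hwz this] eventually_gt_at_top[of 0]]
    obtain K where K: "a < - ln (mcdf H (w K)) - - ln (mcdf H (z K))" "0 < K"
      using eventually_happens by force
    from order_tendstoD(1)[OF tendsto_diff[OF full[OF wz(1)] full[OF wz(2)]] K(1)] K(2)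
    have "\<forall>\<^sub>F n in sequentially. a < real n * (1 - mcdf G (V n (w K))) - real n * (1 - mcdf G (V n (z K)))"
      by simp
    then show "\<forall>\<^sub>F n in sequentially. a < real n * (1 - sub_mcdf G A (V n x))"
      by eventually_elim (rule less_le_trans[OF _ low])
  next
    fix a assume "- ln (sub_mcdf H A x) < a"
    from eventually_conj[OF order_tendstoD(2)[OF Hw this] eventually_gt_at_top[of 0]]
    obtain K where K: "- ln (mcdf H (w K)) < a" "0 < K"
      using eventually_happens by force
    from order_tendstoD(2)[OF full[OF wz(1)[OF K(2)]] K(1)]
    show "\<forall>\<^sub>F n in sequentially. real n * (1 - sub_mcdf G A (V n x)) < a"
      by eventually_elim (rule le_less_trans[OF up])
  qed
  then show ?thesis by (simp add: V_def)
qed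

text \<open>Multiplied by \<open>n\<close>, \<open>sub_mcdf_diff_le\<close> bounds the change of the
  joint rate by the changes of the marginal rates. These tend to 0 because both level sequences have
  the same marginal limits \<open>t i\<close>.\<close>

lemma exceedance_limit_change_levels:
  fixes G :: "(real^'d) measure"
  assumes G: "prob_law G"
    and v: "\<And>i. i \<in> A \<Longrightarrow> (\<lambda>n. real n * (1 - sub_mcdf G {i} (v n))) \<longlonglongrightarrow> t i"
    and w: "\<And>i. i \<in> A \<Longrightarrow> (\<lambda>n. real n * (1 - sub_mcdf G {i} (w n))) \<longlonglongrightarrow> t i"
    and L: "(\<lambda>n. real n * (1 - sub_mcdf G A (v n))) \<longlonglongrightarrow> L"
  shows "(\<lambda>n. real n * (1 - sub_mcdf G A (w n))) \<longlonglongrightarrow> L"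
proof -
  have "(\<lambda>n. \<Sum>i\<in>A. \<bar>real n * (1 - sub_mcdf G {i} (v n)) - real n * (1 - sub_mcdf G {i} (w n))\<bar>)
      \<longlonglongrightarrow> (\<Sum>i\<in>A. \<bar>t i - t i\<bar>)"
    by (intro tendsto_intros v w)
  then have lim: "(\<lambda>n. \<Sum>i\<in>A. \<bar>real n * (1 - sub_mcdf G {i} (v n)) - real n * (1 - sub_mcdf G {i} (w n))\<bar>) \<longlonglongrightarrow> 0"
    by simp
  have "(\<lambda>n. real n * (1 - sub_mcdf G A (w n)) - real n * (1 - sub_mcdf G A (v n))) \<longlonglongrightarrow> 0"
  proof (rule Lim_null_comparison[OF always_eventually[OF allI] lim])
    fix n
    have abs_eq: "\<bar>real n * (1 - p) - real n * (1 - q)\<bar> = real n * \<bar>p - q\<bar>" for p q :: real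
    proof -
      have "real n * (1 - p) - real n * (1 - q) = real n * - (p - q)"
        by (simp add: algebra_simps)
      then show ?thesis
        by (simp only: abs_mult abs_minus_cancel abs_of_nat)
    qed
    have "real n * \<bar>sub_mcdf G A (w n) - sub_mcdf G A (v n)\<bar>
        \<le> real n * (\<Sum>i\<in>A. \<bar>sub_mcdf G {i} (v n) - sub_mcdf G {i} (w n)\<bar>)"
      by (subst abs_minus_commute, intro mult_left_mono sub_mcdf_diff_le G) auto
    then show "norm (real n * (1 - sub_mcdf G A (w n)) - real n * (1 - sub_mcdf G A (v n)))
        \<le> (\<Sum>i\<in>A. \<bar>real n * (1 - sub_mcdf G {i} (v n)) - real n * (1 - sub_mcdf G {i} (w n))\<bar>)"
      by (simp only: real_norm_def abs_eq sum_distrib_left)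
  qed
  from tendsto_add[OF this L] show ?thesis by simp
qed

text \<open>Serves to enter the definition of \<open>mev\<close>, which asserts convergence at
  continuity points only; \<open>sub_mcdf_diff_le\<close> reduces joint continuity to that of the
  margins.\<close>

lemma isCont_mcdf:
  fixes H :: "(real^'d) measure"
  assumes H: "prob_law H" and margins: "\<And>i. isCont (\<lambda>s. sub_mcdf H {i} (\<chi> _. s)) (x $ i)"
  shows "isCont (mcdf H) x"
proof -
  have nth: "sub_mcdf H {i} y = sub_mcdf H {i} (\<chi> _. y $ i)" for i y
    by (rule sub_mcdf_cong) simp
  have "((\<lambda>y. sub_mcdf H {i} y) \<longlongrightarrow> sub_mcdf H {i} x) (at x)" for i
  proof -
    have "((\<lambda>y. sub_mcdf H {i} (\<chi> _. y $ i)) \<longlongrightarrow> sub_mcdf H {i} (\<chi> _. x $ i)) (at x)"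
      by (rule isCont_tendsto_compose[OF margins]) (intro tendsto_intros)
    then show ?thesis by (simp only: nth[symmetric])
  qed
  then have "((\<lambda>y. \<Sum>i\<in>UNIV. \<bar>sub_mcdf H {i} y - sub_mcdf H {i} x\<bar>)
      \<longlongrightarrow> (\<Sum>i\<in>UNIV. \<bar>sub_mcdf H {i} x - sub_mcdf H {i} x\<bar>)) (at x)"
    by (intro tendsto_intros)
  then have bound: "((\<lambda>y. \<Sum>i\<in>UNIV. \<bar>sub_mcdf H {i} y - sub_mcdf H {i} x\<bar>) \<longlongrightarrow> 0) (at x)"
    by simp
  have "((\<lambda>y. mcdf H y - mcdf H x) \<longlongrightarrow> 0) (at x)"
    by (rule Lim_null_comparison[OF always_eventually[OF allI] bound])
      (use sub_mcdf_diff_le[OF H, of UNIV] in \<open>simp only: sub_mcdf_UNIV real_norm_def\<close>)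
  then show ?thesis
    unfolding isCont_def by (rule LIM_zero_cancel)
qed

section \<open>Max-stability\<close>

text \<open>
  Along the subsequence \<open>n * k\<close> the levels at \<open>x\<close> and the levels at index \<open>n\<close> and argument
  \<open>k *\<^sub>R x\<close> have the same marginal exceedance rates, so they can be exchanged. This
  replaces the convergence of types theorem.
\<close>

lemma mev_max_stable:
  fixes H :: "(real^'d) measure"
  assumes mev: "mev H" and pos: "\<And>x. (\<forall>i. 0 < x $ i) \<Longrightarrow> 0 < mcdf H x"
    and margins: "\<And>i s. 0 < s \<Longrightarrow> sub_mcdf H {i} (\<chi> _. s) = exp (- (c i / s))"
    and x: "\<forall>i. 0 < x $ i" and k: "1 \<le> k"
  shows "mcdf H x = mcdf H (real k *\<^sub>R x) ^ k"
proof -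
  from mev obtain G a b where H: "prob_law H" and G: "prob_law G" and a: "\<And>n i. 0 < a n $ i"
    and lim: "\<And>x. isCont (mcdf H) x \<Longrightarrow>
      (\<lambda>n. mcdf G (\<chi> i. a n $ i * x $ i + b n $ i) ^ n) \<longlonglongrightarrow> mcdf H x"
    unfolding mev_def by blast
  define U where "U n i s = a n $ i * s + b n $ i" for n i s
  have U: "mono (U n i)" for n i
    using a[of n i] by (auto simp: U_def intro!: monoI)
  \<comment> \<open>At positive points the margins are exponentials and hence continuous, so
    \<open>lim\<close> applies there.\<close>
  have cont: "isCont (mcdf H) y" if y: "\<forall>i. 0 < y $ i" for y
  proof (rule isCont_mcdf[OF H])
    fix i
    have "\<forall>\<^sub>F s in nhds (y $ i). sub_mcdf H {i} (\<chi> _. s) = exp (- (c i / s))"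
      using y by (intro eventually_mono[OF eventually_nhds_in_open[of "{0<..}" "y $ i"]]) (auto simp: margins)
    moreover have "isCont (\<lambda>s. exp (- (c i / s))) (y $ i)"
      using y[rule_format, of i] by (intro continuous_intros) auto
    ultimately show "isCont (\<lambda>s. sub_mcdf H {i} (\<chi> _. s)) (y $ i)"
      by (simp add: isCont_cong)
  qed
  note exceed = sub_mcdf_exceedance_limit[OF G H U lim[OF cont, folded U_def] pos]
  have margin: "- ln (sub_mcdf H {i} y) = c i / y $ i" if "\<forall>i. 0 < y $ i" for y i
  proof -
    have "sub_mcdf H {i} y = sub_mcdf H {i} (\<chi> _. y $ i)"
      by (rule sub_mcdf_cong) simp
    then show ?thesis using that by (simp add: margins)
  qed
  have kx: "\<forall>i. 0 < (real k *\<^sub>R x) $ i"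
    using x k by simp
  \<comment> \<open>Along the subsequence the rates carry the factor \<open>n * k\<close>; dividing
    by \<open>k\<close> leaves the factor \<open>n\<close>.\<close>
  have sub: "(\<lambda>n. real n * (1 - sub_mcdf G A (\<chi> i. U (n * k) i (x $ i)))) \<longlonglongrightarrow> - ln (sub_mcdf H A x) / k" for A
  proof -
    have "strict_mono (\<lambda>n. n * k)"
      using k by (auto simp: strict_mono_def)
    from LIMSEQ_subseq_LIMSEQ[OF exceed[OF _ _ x] this, of A]
    have "(\<lambda>n. real (n * k) * (1 - sub_mcdf G A (\<chi> i. U (n * k) i (x $ i))) / k) \<longlonglongrightarrow> - ln (sub_mcdf H A x) / k"
      using k by (intro tendsto_intros) (auto simp: comp_def)
    then show ?thesis
      using k by simp
  qed
  have "(\<lambda>n. real n * (1 - sub_mcdf G UNIV (\<chi> i. U n i ((real k *\<^sub>R x) $ i)))) \<longlonglongrightarrow> - ln (sub_mcdf H UNIV x) / k"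
  proof (rule exceedance_limit_change_levels[OF G _ _ sub])
    fix i
    \<comment> \<open>Both marginal limits are \<open>c i / (k * x $ i)\<close>: here
      \<open>k\<close> comes from the division of the rate, below from the scaled argument.\<close>
    show "(\<lambda>n. real n * (1 - sub_mcdf G {i} (\<chi> i. U (n * k) i (x $ i)))) \<longlonglongrightarrow> c i / x $ i / k"
      using sub[of "{i}"] by (simp add: margin[OF x])
    show "(\<lambda>n. real n * (1 - sub_mcdf G {i} (\<chi> i. U n i ((real k *\<^sub>R x) $ i)))) \<longlonglongrightarrow> c i / x $ i / k"
      using exceed[OF _ _ kx, of "{i}"] by (simp add: margin[OF kx] mult.commute)
  qed
  from LIMSEQ_unique[OF this exceed[OF _ _ kx]]
  have "ln (mcdf H x) = real k * ln (mcdf H (real k *\<^sub>R x))"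
    using k by (simp add: sub_mcdf_UNIV field_simps)
  also have "\<dots> = ln (mcdf H (real k *\<^sub>R x) ^ k)"
    by (rule ln_realpow[symmetric])
  finally show ?thesis
    using ln_inj_iff[OF pos[OF x] zero_less_power[OF pos[OF kx]]] by blast
qed

text \<open>Stability survives sending the coordinates outside \<open>A\<close> to infinity, since
  scaling by \<open>k\<close> keeps them tending to infinity.\<close>

lemma sub_mcdf_max_stable:
  fixes H :: "(real^'d) measure"
  assumes H: "prob_law H"
    and stable: "\<And>x k. (\<forall>i. 0 < x $ i) \<Longrightarrow> 1 \<le> k \<Longrightarrow> mcdf H x = mcdf H (real k *\<^sub>R x) ^ k"
    and x: "\<forall>i. 0 < x $ i" and k: "1 \<le> k"
  shows "sub_mcdf H A x = sub_mcdf H A (real k *\<^sub>R x) ^ k"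
proof (rule tendsto_unique[OF trivial_limit_at_top_linorder])
  let ?w = "\<lambda>K. \<chi> i. if i \<in> A then x $ i else K"
  show "((\<lambda>K. mcdf H (?w K)) \<longlongrightarrow> sub_mcdf H A x) at_top"
    by (rule sub_mcdf_limit[OF H]) (auto simp: filterlim_ident)
  have scale: "filterlim (\<lambda>K. real k * K) at_top at_top"
    using k by (intro filterlim_tendsto_pos_mult_at_top[OF tendsto_const _ filterlim_ident]) auto
  have "((\<lambda>K. mcdf H (real k *\<^sub>R ?w K) ^ k) \<longlongrightarrow> sub_mcdf H A (real k *\<^sub>R x) ^ k) at_top"
    by (intro tendsto_power sub_mcdf_limit[OF H]) (auto simp: scale)
  moreover have "\<forall>\<^sub>F K in at_top. mcdf H (real k *\<^sub>R ?w K) ^ k = mcdf H (?w K)"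
    using eventually_gt_at_top[of 0]
  proof eventually_elim
    case (elim K)
    then show ?case using x k by (intro stable[symmetric]) auto
  qed
  ultimately show "((\<lambda>K. mcdf H (?w K)) \<longlongrightarrow> sub_mcdf H A (real k *\<^sub>R x) ^ k) at_top"
    by (rule Lim_transform_eventually)
qed

text \<open>For \<open>g s = - ln (f (1 / s))\<close> the hypothesis reads
  \<open>g (k * s) = k * g s\<close>. A monotone function that is homogeneous under positive
  integers is linear.\<close>

lemma powr_if_power_scaling:
  fixes f :: "real \<Rightarrow> real"
  assumes mono: "\<And>x y. 0 < x \<Longrightarrow> x \<le> y \<Longrightarrow> f x \<le> f y"
    and pos: "\<And>x. 0 < x \<Longrightarrow> 0 < f x"
    and scale: "\<And>x k. 0 < x \<Longrightarrow> 1 \<le> k \<Longrightarrow> f x = f (real k * x) ^ k"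
    and "0 < x"
  shows "f x = f 1 powr (1 / x)"
proof -
  define g where "g s = - ln (f (1 / s))" for s
  have g_mono: "g s \<le> g t" if "0 < s" "s \<le> t" for s t
    using that mono[of "1 / t" "1 / s"] pos[of "1 / t"] pos[of "1 / s"] by (simp add: g_def frac_le)
  have g_scale: "g (real k * s) = real k * g s" if "0 < s" "1 \<le> k" for k s
    using scale[of "1 / (real k * s)" k] that pos[of "1 / s"] by (simp add: g_def ln_realpow)
  define s where "s = 1 / x"
  have s: "0 < s" using \<open>0 < x\<close> by (simp add: s_def)
  \<comment> \<open>With \<open>m\<close> the integer part of \<open>n * s\<close>, both
    \<open>n * g s\<close> and \<open>n * s * g 1\<close> lie between \<open>m * g 1\<close> and
    \<open>(m + 1) * g 1\<close>, so they differ by at most \<open>g 1\<close> whatever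
    \<open>n\<close> is. The condition on \<open>n\<close> makes \<open>m\<close> at least 1, as
    \<open>g_scale\<close> demands.\<close>
  have bound: "real n * \<bar>g s - s * g 1\<bar> \<le> g 1" if n: "1 / s \<le> real n" for n
  proof -
    define m where "m = nat \<lfloor>real n * s\<rfloor>"
    have "0 < 1 / s" using s by simp
    with n have n1: "1 \<le> n" by (cases n) auto
    have ns: "1 \<le> real n * s" using n s by (simp add: field_simps)
    then have m: "real m \<le> real n * s" "real n * s \<le> real m + 1" "1 \<le> m"
      unfolding m_def by linarith+
    have "real m * g 1 \<le> real n * g s"
      using g_mono[of "real m" "real n * s"] g_scale[of 1 m] g_scale[of s n] m s n1 by simp
    moreover have "real n * g s \<le> (real m + 1) * g 1"
      using g_mono[of "real n * s" "real (m + 1)"] g_scale[of 1 "m + 1"] g_scale[of s n] m s n1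
      by (simp add: add.commute)
    \<comment> \<open>Monotonicity and scaling give \<open>g 1 \<le> g 2 = 2 * g 1\<close>.\<close>
    moreover have g1: "0 \<le> g 1"
      using g_mono[of 1 2] g_scale[of 1 2] by simp
    have "real m * g 1 \<le> real n * s * g 1" "real n * s * g 1 \<le> (real m + 1) * g 1"
      using m g1 by (intro mult_right_mono; simp)+
    ultimately have "\<bar>real n * g s - real n * s * g 1\<bar> \<le> g 1"
      by (simp add: abs_le_iff algebra_simps)
    also have "real n * g s - real n * s * g 1 = real n * (g s - s * g 1)"
      by (simp add: algebra_simps)
    finally show ?thesis by (simp add: abs_mult)
  qed
  have "g s = s * g 1"
  proof (rule ccontr)
    assume "g s \<noteq> s * g 1"
    then have d: "0 < \<bar>g s - s * g 1\<bar>" by simp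
    obtain n where n: "g 1 < real n * \<bar>g s - s * g 1\<bar>"
      using reals_Archimedean3[OF d] by blast
    obtain N where N: "1 / s \<le> real N" using real_arch_simple by blast
    \<comment> \<open>Taking the maximum with \<open>N\<close> makes the index large enough for
      \<open>bound\<close> while keeping the product above \<open>g 1\<close>.\<close>
    have "real n * \<bar>g s - s * g 1\<bar> \<le> real (max n N) * \<bar>g s - s * g 1\<bar>"
      by (intro mult_right_mono) auto
    moreover have "1 / s \<le> real (max n N)"
      using N by simp
    ultimately show False
      using n bound[of "max n N"] by linarith
  qed
  then have "ln (f x) = 1 / x * ln (f 1)"
    by (simp add: g_def s_def)
  moreover have "f x = exp (ln (f x))"
    using pos[OF \<open>0 < x\<close>] by simp
  ultimately show ?thesis
    using pos[of 1] by (simp add: powr_def)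
qed

section \<open>Tail dependence of max-stable laws\<close>

text \<open>The point \<open>- c i / ln v\<close> is the \<open>v\<close>-quantile of margin
  \<open>i\<close>, so exceeding the marginal level \<open>v\<close> means exceeding this point.
  These quantiles form a multiple of the vector \<open>c\<close>. Inclusion-exclusion gives the
  numerator.\<close>

lemma tail_prob_eq:
  fixes H :: "(real^'d) measure"
  assumes H: "prob_law H" and c: "\<And>i. 0 < c i"
    and margins: "\<And>i s. 0 < s \<Longrightarrow> sub_mcdf H {i} (\<chi> _. s) = exp (- (c i / s))"
    and v: "0 < v" "v < 1"
  shows "tail_prob H j j' v = (1 - 2 * v + sub_mcdf H {j, j'} ((- 1 / ln v) *\<^sub>R (\<chi> i. c i))) / (1 - v)"
proof -
  interpret prob_space H using H by (rule prob_law_prob_space)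
  define q where "q i = - 1 / ln v * c i" for i
  have ln: "ln v < 0" using v by simp
  then have q: "0 < q i" for i
    using c[of i] by (simp add: q_def divide_pos_neg mult_neg_pos)
  have "cdf (margin H i) (q i) = v" for i
  proof -
    have "c i / q i = - ln v"
      using c[of i] ln by (simp add: q_def field_simps)
    then show ?thesis using v by (simp add: cdf_margin[OF H] margins[OF q])
  qed
  moreover have "cdf (margin H i) s > cdf (margin H i) (q i) \<longleftrightarrow> q i < s" for i s
  proof
    assume "q i < s"
    then show "cdf (margin H i) (q i) < cdf (margin H i) s"
      using q[of i] c[of i] by (simp add: cdf_margin[OF H] margins frac_less2)
  next
    assume less: "cdf (margin H i) (q i) < cdf (margin H i) s"
    \<comment> \<open>Monotonicity is used here because \<open>s\<close> may be nonpositive, where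
      \<open>margins\<close> gives no formula.\<close>
    have "cdf (margin H i) s \<le> cdf (margin H i) (q i)" if "s \<le> q i"
      unfolding cdf_margin[OF H] using that by (intro sub_mcdf_mono[OF H]) auto
    with less show "q i < s" by force
  qed
  ultimately have exceed: "v < cdf (margin H i) s \<longleftrightarrow> q i < s" for i s
    by metis
  define E where "E i = {y :: real^'d. \<forall>i\<in>{i}. y $ i \<le> (\<chi> i. q i) $ i}" for i
  have E: "E i \<in> events" for i
    unfolding E_def by (rule orthant_sets[OF H])
  have E_prob: "prob (E i) = v" for i
  proof -
    have "prob (E i) = sub_mcdf H {i} (\<chi> _. q i)"
      by (simp add: E_def sub_mcdf_def)
    then show ?thesis
      using \<open>cdf (margin H i) (q i) = v\<close> by (simp add: cdf_margin[OF H])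
  qed
  have E_Int: "prob (E j \<inter> E j') = sub_mcdf H {j, j'} ((- 1 / ln v) *\<^sub>R (\<chi> i. c i))"
    unfolding sub_mcdf_def by (rule arg_cong[where f = prob]) (auto simp: E_def q_def)
  have compl: "{y \<in> space H. v < cdf (margin H i) (y $ i)} = space H - E i" for i
    by (auto simp: exceed E_def)
  have "{y \<in> space H. v < cdf (margin H j) (y $ j) \<and> v < cdf (margin H j') (y $ j')} = space H - (E j \<union> E j')"
    by (auto simp: exceed E_def)
  then have "tail_prob H j j' v = prob (space H - (E j \<union> E j')) / prob (space H - E j')"
    by (simp add: tail_prob_def cond_prob_def compl)
  also have "prob (space H - E j') = 1 - v"
    using prob_compl[OF E] by (simp add: E_prob)
  also have "prob (space H - (E j \<union> E j')) = 1 - prob (E j \<union> E j')"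
    using E by (intro prob_compl) auto
  also have "prob (E j \<union> E j') = v + v - prob (E j \<inter> E j')"
    using measure_Un3[of "E j" H "E j'"] E by (simp add: E_prob fmeasurable_eq_sets)
  finally show ?thesis
    by (simp add: E_Int)
qed

text \<open>Max-stability along the ray through \<open>c\<close> turns \<open>tail_prob_eq\<close>
  into 2 minus the difference quotient of \<open>v powr L\<close> at 1, which tends to the
  derivative \<open>L\<close>.\<close>

lemma tail_prob_tendsto:
  fixes H :: "(real^'d) measure"
  assumes H: "prob_law H" and c: "\<And>i. 0 < c i"
    and margins: "\<And>i s. 0 < s \<Longrightarrow> sub_mcdf H {i} (\<chi> _. s) = exp (- (c i / s))"
    and pos: "\<And>x. (\<forall>i. 0 < x $ i) \<Longrightarrow> 0 < mcdf H x"
    and stable: "\<And>x k. (\<forall>i. 0 < x $ i) \<Longrightarrow> 1 \<le> k \<Longrightarrow> mcdf H x = mcdf H (real k *\<^sub>R x) ^ k"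
  shows "(tail_prob H j j' \<longlongrightarrow> 2 + ln (sub_mcdf H {j, j'} (\<chi> i. c i))) (at_left 1)"
proof -
  define f where "f x = sub_mcdf H {j, j'} (x *\<^sub>R (\<chi> i. c i))" for x
  define L where "L = - ln (f 1)"
  have f_pos: "0 < f x" if "0 < x" for x
    unfolding f_def using that c by (intro sub_mcdf_pos[OF H] pos) auto
  have f: "f x = f 1 powr (1 / x)" if "0 < x" for x
  proof (rule powr_if_power_scaling[OF _ f_pos _ that])
    show "f x \<le> f y" if "0 < x" "x \<le> y" for x y
      unfolding f_def using that c less_imp_le by (intro sub_mcdf_mono[OF H]) (auto intro!: mult_right_mono)
    show "f x = f (real k * x) ^ k" if "0 < x" "1 \<le> k" for x k
      using sub_mcdf_max_stable[OF H stable, of "x *\<^sub>R (\<chi> i. c i)" k] that c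
      by (simp add: f_def)
  qed
  have tail: "tail_prob H j j' v = 2 - (v powr L - 1) / (v - 1)" if v: "0 < v" "v < 1" for v
  proof -
    have "ln v < 0" using v by simp
    then have "f (- 1 / ln v) = f 1 powr (- ln v)"
      by (subst f) (auto simp: divide_neg_neg)
    also have "\<dots> = v powr L"
      using v f_pos[of 1] by (simp add: powr_def L_def)
    finally have "tail_prob H j j' v = (1 - 2 * v + v powr L) / (1 - v)"
      using tail_prob_eq[OF H c margins v, where ?j = j and ?j' = j'] by (simp add: f_def)
    also have "\<dots> = 2 - (v powr L - 1) / (v - 1)"
      using v by (simp add: divide_simps) (simp add: algebra_simps)
    finally show ?thesis .
  qed
  have "((\<lambda>v. v powr L) has_real_derivative L * 1 powr (L - 1)) (at 1)"
    by (rule has_real_derivative_powr) simp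
  then have "((\<lambda>v. (v powr L - 1) / (v - 1)) \<longlongrightarrow> L) (at 1)"
    by (simp add: has_field_derivative_iff)
  then have "((\<lambda>v. 2 - (v powr L - 1) / (v - 1)) \<longlongrightarrow> 2 - L) (at_left 1)"
    by (intro tendsto_intros) (rule filterlim_mono[OF _ order_refl at_le], auto)
  moreover have "\<forall>\<^sub>F v in at_left (1::real). 2 - (v powr L - 1) / (v - 1) = tail_prob H j j' v"
    using eventually_at_left_real[of 0 1] by (auto elim!: eventually_mono simp: tail)
  ultimately have "(tail_prob H j j' \<longlongrightarrow> 2 - L) (at_left 1)"
    by (rule Lim_transform_eventually)
  then show ?thesis
    by (simp add: L_def f_def)
qed

section \<open>Maxima of independent and of stationary vectors\<close>

lemma cmax_le_iff:
  assumes "1 \<le> n"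
  shows "cmax n y \<le> x \<longleftrightarrow> (\<forall>m\<in>{1..n}. \<forall>i. y m $ i \<le> x $ i)"
  using assms by (auto simp: cmax_def less_eq_vec_def)

lemma iid_max_prob_eq_power:
  fixes G :: "(real^'d) measure"
  assumes G: "prob_law G" and n: "1 \<le> n"
  shows "iid_max_prob G n x = mcdf G x ^ n"
proof -
  interpret prob_space G using G by (rule prob_law_prob_space)
  interpret finite_product_prob_space "\<lambda>_. G" "{1..n}"
    by unfold_locales simp
  have "{y \<in> space (PiM {1..n} (\<lambda>_. G)). cmax n y \<le> x} = Pi\<^sub>E {1..n} (\<lambda>_. {..x})"
    unfolding cmax_le_iff[OF n]
    by (auto simp: space_PiM prob_law_space[OF G] less_eq_vec_def PiE_def Pi_def)
  then have "iid_max_prob G n x = measure (PiM {1..n} (\<lambda>_. G)) (Pi\<^sub>E {1..n} (\<lambda>_. {..x}))"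
    by (simp only: iid_max_prob_def)
  also have "\<dots> = (\<Prod>m\<in>{1..n}. measure G {..x})"
    by (rule finite_measure_PiM_emb) (simp add: prob_law_sets[OF G])
  finally show ?thesis
    by (simp add: mcdf_def)
qed

text \<open>With linear norming, the level of index \<open>n * k\<close> at \<open>x\<close> is the
  level of index \<open>n\<close> at \<open>real k *\<^sub>R x\<close>. The same subsequence thus
  has both sides as its limit.\<close>

lemma iid_limit_max_stable:
  fixes F H :: "(real^'d) measure"
  assumes lim: "\<And>x. (\<lambda>n. mcdf F (real n *\<^sub>R x) ^ n) \<longlonglongrightarrow> mcdf H x" and k: "1 \<le> k"
  shows "mcdf H x = mcdf H (real k *\<^sub>R x) ^ k"
proof (rule LIMSEQ_unique)
  have "strict_mono (\<lambda>n. n * k)"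
    using k by (auto simp: strict_mono_def)
  from LIMSEQ_subseq_LIMSEQ[OF lim[of x] this]
  show "(\<lambda>n. mcdf F (real (n * k) *\<^sub>R x) ^ (n * k)) \<longlonglongrightarrow> mcdf H x"
    by (simp add: comp_def)
  show "(\<lambda>n. mcdf F (real (n * k) *\<^sub>R x) ^ (n * k)) \<longlonglongrightarrow> mcdf H (real k *\<^sub>R x) ^ k"
    using tendsto_power[OF lim[of "real k *\<^sub>R x"], of k] by (simp add: power_mult)
qed

text \<open>The values at \<open>real k *\<^sub>R x\<close> tend to 1, so one of them is positive,
  and its \<open>k\<close>-th power is the value at \<open>x\<close>.\<close>

lemma max_stable_pos:
  fixes H :: "(real^'d) measure"
  assumes H: "prob_law H" and x: "\<forall>i. 0 < x $ i"
    and stable: "\<And>k. 1 \<le> k \<Longrightarrow> mcdf H x = mcdf H (real k *\<^sub>R x) ^ k"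
  shows "0 < mcdf H x"
proof -
  interpret prob_space H using H by (rule prob_law_prob_space)
  have "filterlim (\<lambda>k. real k * x $ i) at_top sequentially" for i
    using x by (intro filterlim_at_top_mult_tendsto_pos[OF tendsto_const _ filterlim_real_sequentially]) auto
  then have "(\<lambda>k. mcdf H (real k *\<^sub>R x)) \<longlonglongrightarrow> sub_mcdf H {} x"
    by (intro sub_mcdf_limit[OF H]) auto
  moreover have "sub_mcdf H {} x = 1"
    using prob_space prob_law_space[OF H] by (simp add: sub_mcdf_def)
  ultimately have "(\<lambda>k. mcdf H (real k *\<^sub>R x)) \<longlonglongrightarrow> 1"
    by simp
  from eventually_conj[OF order_tendstoD(1)[OF this zero_less_one] eventually_ge_at_top[of 1]]
  obtain k where "0 < mcdf H (real k *\<^sub>R x)" "1 \<le> k"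
    using eventually_happens by force
  then show ?thesis
    using stable by simp
qed

text \<open>Stationarity is applied to a window of length 1: shifted by \<open>m - 1\<close> it
  carries \<open>X m\<close>, unshifted \<open>X 1\<close>.\<close>

lemma stationary_margin:
  fixes X :: "nat \<Rightarrow> 'a \<Rightarrow> real^'d"
  assumes X: "stationary M X" and m: "1 \<le> m"
  shows "\<P>(\<omega> in M. X m \<omega> $ i \<le> a $ i) = sub_mcdf (distr M borel (X 1)) {i} a"
proof -
  have meas: "X k \<in> borel_measurable M" if "1 \<le> k" for k
    using X that by (simp add: stationary_def)
  define P where "P = PiM {1..1::nat} (\<lambda>_. borel :: (real^'d) measure)"
  define Z where "Z h = (\<lambda>\<omega>. \<lambda>k\<in>{1..1}. X (k + h) \<omega>)" for h
  have Z: "Z h \<in> measurable M P" for h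
    unfolding Z_def P_def by (intro measurable_restrict meas) auto
  have same: "distr M P (Z (m - 1)) = distr M P (Z 0)"
    using X[unfolded stationary_def, THEN conjunct2, rule_format, of 1 "m - 1"]
    by (simp only: Z_def P_def add_0_right)
  define S where "S = (\<lambda>f. f 1) -` {y. \<forall>k\<in>{i}. y $ k \<le> a $ k} \<inter> space P"
  have S: "S \<in> sets P"
    unfolding S_def P_def
    by (rule measurable_sets[OF _ orthant_borel], rule measurable_component_singleton) simp
  have "measure (distr M P (Z h)) S = \<P>(\<omega> in M. X (Suc h) \<omega> $ i \<le> a $ i)" for h
  proof -
    have "Z h -` S \<inter> space M = {\<omega> \<in> space M. X (Suc h) \<omega> $ i \<le> a $ i}"
      using measurable_space[OF Z] by (auto simp: S_def Z_def)
    then show ?thesis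
      by (simp add: measure_distr[OF Z S])
  qed
  from this[of "m - 1"] this[of 0]
  have "\<P>(\<omega> in M. X m \<omega> $ i \<le> a $ i) = \<P>(\<omega> in M. X 1 \<omega> $ i \<le> a $ i)"
    using m same by simp
  also have "\<dots> = measure M (X 1 -` {y. \<forall>k\<in>{i}. y $ k \<le> a $ k} \<inter> space M)"
    by (rule arg_cong[where f = "measure M"]) auto
  also have "\<dots> = sub_mcdf (distr M borel (X 1)) {i} a"
    unfolding sub_mcdf_def using meas[of 1] orthant_borel by (intro measure_distr[symmetric]) auto
  finally show ?thesis .
qed

text \<open>A bound on the maximum constrains each coordinate of each of the \<open>n\<close>
  vectors. \<open>prob_all_le_diff\<close> treats all of these at once, and by stationarity every
  time contributes the same sum.\<close>

lemma max_prob_diff_le: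
  fixes X :: "nat \<Rightarrow> 'a \<Rightarrow> real^'d"
  assumes "prob_space M" and X: "stationary M X" and n: "1 \<le> n"
  shows "\<bar>max_prob M X n x - max_prob M X n y\<bar>
    \<le> (\<Sum>i\<in>UNIV. real n * \<bar>sub_mcdf (distr M borel (X 1)) {i} x - sub_mcdf (distr M borel (X 1)) {i} y\<bar>)"
proof -
  interpret prob_space M by fact
  let ?I = "{1..n} \<times> (UNIV :: 'd set)" and ?Y = "\<lambda>p \<omega>. X (fst p) \<omega> $ snd p"
  have max_prob: "max_prob M X n z = \<P>(\<omega> in M. \<forall>p\<in>?I. ?Y p \<omega> \<le> z $ snd p)" for z
    unfolding max_prob_def cmax_le_iff[OF n] by (rule arg_cong[where f = prob]) auto
  have meas: "?Y p \<in> borel_measurable M" if "p \<in> ?I" for p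
  proof -
    have "X (fst p) \<in> borel_measurable M"
      using X that by (auto simp: stationary_def)
    from measurable_compose[OF this, of "\<lambda>y. y $ snd p" borel] show ?thesis by simp
  qed
  have "\<bar>max_prob M X n x - max_prob M X n y\<bar>
      \<le> (\<Sum>p\<in>?I. \<bar>\<P>(\<omega> in M. ?Y p \<omega> \<le> x $ snd p) - \<P>(\<omega> in M. ?Y p \<omega> \<le> y $ snd p)\<bar>)"
    unfolding max_prob by (rule prob_all_le_diff[OF _ meas]) auto
  also have "\<dots> = (\<Sum>p\<in>?I. \<bar>sub_mcdf (distr M borel (X 1)) {snd p} x - sub_mcdf (distr M borel (X 1)) {snd p} y\<bar>)"
    by (rule sum.cong) (auto simp: stationary_margin[OF X])
  also have "\<dots> = (\<Sum>m\<in>{1..n}. \<Sum>i\<in>UNIV. \<bar>sub_mcdf (distr M borel (X 1)) {i} x - sub_mcdf (distr M borel (X 1)) {i} y\<bar>)"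
    by (simp only: sum.cartesian_product split_def)
  finally show ?thesis
    by (simp add: sum_distrib_left)
qed

section \<open>The limit laws and the extremal index\<close>

locale extremal_index_setting = prob_space M
  for M :: "'a measure" +
  fixes X :: "nat \<Rightarrow> 'a \<Rightarrow> real^'d" and u :: "nat \<Rightarrow> 'd \<Rightarrow> real \<Rightarrow> real"
    and \<theta> :: "real^'d \<Rightarrow> real" and H Hhat :: "(real^'d) measure"
  assumes stationary: "stationary M X"
    and H: "prob_law H" and Hhat: "prob_law Hhat"
    and frechet: "unit_frechet_margins Hhat"
    and iid_lim: "\<And>x. (\<lambda>n. mcdf (distr M borel (X 1)) (real n *\<^sub>R x) ^ n) \<longlonglongrightarrow> mcdf Hhat x"
    and max_lim: "\<And>x. (\<lambda>n. max_prob M X n (real n *\<^sub>R x)) \<longlonglongrightarrow> mcdf H x"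
    and index: "has_multivariate_extremal_index M X u \<theta>"
begin

definition F :: "(real^'d) measure" where
  "F = distr M borel (X 1)"

lemma X1: "X 1 \<in> borel_measurable M"
  using stationary by (simp add: stationary_def)

lemma F: "prob_law F"
  using prob_space_distr[OF X1] by (simp add: prob_law_def F_def)

lemma prob_exceed:
  "\<P>(\<omega> in M. \<exists>i\<in>A. x $ i < X 1 \<omega> $ i) = 1 - sub_mcdf F A x"
proof -
  let ?O = "{y. \<forall>i\<in>A. y $ i \<le> x $ i}"
  have "sub_mcdf F A x = prob (X 1 -` ?O \<inter> space M)"
    unfolding sub_mcdf_def F_def using X1 orthant_borel by (intro measure_distr) auto
  moreover have "{\<omega> \<in> space M. \<exists>i\<in>A. x $ i < X 1 \<omega> $ i} = space M - (X 1 -` ?O \<inter> space M)"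
    by (auto simp: not_le)
  moreover have "X 1 -` ?O \<inter> space M \<in> events"
    using X1 orthant_borel by (rule measurable_sets)
  ultimately show ?thesis
    by (simp add: prob_compl)
qed

lemma Hhat_stable: "1 \<le> k \<Longrightarrow> mcdf Hhat x = mcdf Hhat (real k *\<^sub>R x) ^ k"
  by (rule iid_limit_max_stable[OF iid_lim])

lemma Hhat_pos: "(\<forall>i. 0 < x $ i) \<Longrightarrow> 0 < mcdf Hhat x"
  by (rule max_stable_pos[OF Hhat _ Hhat_stable])

lemma Hhat_margin: "0 < s \<Longrightarrow> sub_mcdf Hhat {i} (\<chi> _. s) = exp (- (1 / s))"
  using frechet by (simp add: unit_frechet_margins_def cdf_margin[OF Hhat])

text \<open>A single margin is already below 1. This keeps the logarithms of \<open>Hhat\<close>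
  away from 0 where they serve as denominators.\<close>

lemma Hhat_less_1:
  assumes "i \<in> A" "0 < x $ i"
  shows "sub_mcdf Hhat A x < 1"
proof -
  have "sub_mcdf Hhat A x \<le> sub_mcdf Hhat {i} (\<chi> _. x $ i)"
    using assms by (intro sub_mcdf_mono[OF Hhat]) auto
  also have "\<dots> < 1"
    using assms by (simp add: Hhat_margin)
  finally show ?thesis .
qed

lemma F_exceedance_limit:
  assumes "\<forall>i. 0 < x $ i"
  shows "(\<lambda>n. real n * (1 - sub_mcdf F A (real n *\<^sub>R x))) \<longlonglongrightarrow> - ln (sub_mcdf Hhat A x)"
proof -
  have scale: "real n *\<^sub>R x = (\<chi> i. real n * x $ i)" for n and x :: "real^'d"
    by (simp add: vec_eq_iff)
  show ?thesis
    unfolding scale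
  proof (rule sub_mcdf_exceedance_limit[OF F Hhat _ _ Hhat_pos assms])
    show "(\<lambda>n. mcdf F (\<chi> i. real n * x $ i) ^ n) \<longlonglongrightarrow> mcdf Hhat x" for x
      using iid_lim[of x] by (simp add: F_def scale)
  qed (auto intro!: monoI mult_left_mono)
qed

lemma level_margin:
  assumes "\<forall>i. 0 < \<tau> $ i"
  shows "(\<lambda>n. real n * (1 - sub_mcdf F {i} (\<chi> i. u n i (\<tau> $ i)))) \<longlonglongrightarrow> \<tau> $ i"
proof -
  have "(\<lambda>n. real n * \<P>(\<omega> in M. X 1 \<omega> $ i > u n i (\<tau> $ i))) \<longlonglongrightarrow> \<tau> $ i"
    using index assms unfolding has_multivariate_extremal_index_def by blast
  then show ?thesis
    by (simp flip: prob_exceed)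
qed

lemma scale_margin:
  assumes "\<forall>i. 0 < \<tau> $ i"
  shows "(\<lambda>n. real n * (1 - sub_mcdf F {i} (real n *\<^sub>R (\<chi> i. 1 / \<tau> $ i)))) \<longlonglongrightarrow> \<tau> $ i"
proof -
  have "sub_mcdf Hhat {i} (\<chi> i. 1 / \<tau> $ i) = sub_mcdf Hhat {i} (\<chi> _. 1 / \<tau> $ i)"
    by (rule sub_mcdf_cong) simp
  then have "- ln (sub_mcdf Hhat {i} (\<chi> i. 1 / \<tau> $ i)) = \<tau> $ i"
    using assms by (simp add: Hhat_margin)
  then show ?thesis
    using F_exceedance_limit[of "\<chi> i. 1 / \<tau> $ i" "{i}"] assms by simp
qed

lemma level_exceedance_limit:
  assumes "\<forall>i. 0 < \<tau> $ i"
  shows "(\<lambda>n. real n * (1 - sub_mcdf F A (\<chi> i. u n i (\<tau> $ i)))) \<longlonglongrightarrow> - ln (sub_mcdf Hhat A (\<chi> i. 1 / \<tau> $ i))"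
  by (rule exceedance_limit_change_levels[OF F scale_margin[OF assms] level_margin[OF assms] F_exceedance_limit])
    (use assms in simp)

lemma level_iid_limit:
  assumes "\<forall>i. 0 < \<tau> $ i"
  shows "(\<lambda>n. iid_max_prob F n (\<chi> i. u n i (\<tau> $ i))) \<longlonglongrightarrow> mcdf Hhat (\<chi> i. 1 / \<tau> $ i)"
proof -
  have "(\<lambda>n. mcdf F (\<chi> i. u n i (\<tau> $ i)) ^ n) \<longlonglongrightarrow> mcdf Hhat (\<chi> i. 1 / \<tau> $ i)"
    using level_exceedance_limit[OF assms, of UNIV] Hhat_pos[of "\<chi> i. 1 / \<tau> $ i"] assms
      sub_mcdf_nonneg[of F UNIV] sub_mcdf_le_1[OF F, of UNIV]
    by (subst power_seq_tendsto_iff) (auto simp: sub_mcdf_UNIV)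
  then show ?thesis
    by (rule Lim_transform_eventually)
      (rule eventually_sequentiallyI[of 1], simp add: iid_max_prob_eq_power[OF F])
qed

text \<open>The maximum of the dependent sequence has no power form, so the levels are exchanged
  inside the probability itself by \<open>max_prob_diff_le\<close>.\<close>

lemma level_max_limit:
  assumes "\<forall>i. 0 < \<tau> $ i"
  shows "(\<lambda>n. max_prob M X n (\<chi> i. u n i (\<tau> $ i))) \<longlonglongrightarrow> mcdf H (\<chi> i. 1 / \<tau> $ i)"
proof -
  define v where "v n = (\<chi> i. u n i (\<tau> $ i))" for n
  define w where "w n = real n *\<^sub>R (\<chi> i. 1 / \<tau> $ i)" for n
  have "(\<lambda>n. \<Sum>i\<in>UNIV. \<bar>real n * (1 - sub_mcdf F {i} (w n)) - real n * (1 - sub_mcdf F {i} (v n))\<bar>)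
      \<longlonglongrightarrow> (\<Sum>i\<in>UNIV. \<bar>\<tau> $ i - \<tau> $ i\<bar>)"
    unfolding v_def w_def by (intro tendsto_intros level_margin scale_margin assms)
  then have bound: "(\<lambda>n. \<Sum>i\<in>UNIV. \<bar>real n * (1 - sub_mcdf F {i} (w n)) - real n * (1 - sub_mcdf F {i} (v n))\<bar>)
      \<longlonglongrightarrow> 0"
    by simp
  have "(\<lambda>n. max_prob M X n (v n) - max_prob M X n (w n)) \<longlonglongrightarrow> 0"
  proof (rule Lim_null_comparison[OF eventually_sequentiallyI[of 1] bound])
    fix n :: nat assume "1 \<le> n"
    have "real n * \<bar>p - q\<bar> = \<bar>real n * (1 - q) - real n * (1 - p)\<bar>" for p q :: real
    proof -
      have "real n * (1 - q) - real n * (1 - p) = real n * (p - q)"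
        by (simp add: algebra_simps)
      then show ?thesis by (simp add: abs_mult)
    qed
    then show "norm (max_prob M X n (v n) - max_prob M X n (w n))
        \<le> (\<Sum>i\<in>UNIV. \<bar>real n * (1 - sub_mcdf F {i} (w n)) - real n * (1 - sub_mcdf F {i} (v n))\<bar>)"
      using max_prob_diff_le[OF prob_space_axioms stationary \<open>1 \<le> n\<close>, of "v n" "w n"]
      by (simp only: real_norm_def F_def)
  qed
  from tendsto_add[OF this max_lim[of "\<chi> i. 1 / \<tau> $ i", folded w_def]]
  show ?thesis by (simp add: v_def)
qed

text \<open>The definition of the index supplies some limit \<open>g\<close>; uniqueness of limits
  identifies it through \<open>level_iid_limit\<close>, and its power through
  \<open>level_max_limit\<close>.\<close>

lemma H_eq_powr:
  assumes "\<forall>i. 0 < \<tau> $ i"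
  shows "mcdf H (\<chi> i. 1 / \<tau> $ i) = mcdf Hhat (\<chi> i. 1 / \<tau> $ i) powr \<theta> \<tau>"
proof -
  obtain g where "(\<lambda>n. iid_max_prob F n (\<chi> j. u n j (\<tau> $ j))) \<longlonglongrightarrow> g"
    and "(\<lambda>n. max_prob M X n (\<chi> j. u n j (\<tau> $ j))) \<longlonglongrightarrow> g powr \<theta> \<tau>"
    using index assms by (auto simp: has_multivariate_extremal_index_def F_def)
  with level_iid_limit[OF assms] level_max_limit[OF assms] show ?thesis
    using LIMSEQ_unique by blast
qed

lemma H_pos:
  assumes "\<forall>i. 0 < x $ i"
  shows "0 < mcdf H x"
proof -
  have "(\<chi> i. 1 / (\<chi> i. 1 / x $ i) $ i) = x"
    by (simp add: vec_eq_iff)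
  then show ?thesis
    using H_eq_powr[of "\<chi> i. 1 / x $ i"] Hhat_pos[OF assms] assms by simp
qed

lemma index_eq:
  assumes "\<forall>i. 0 < \<tau> $ i"
  shows "\<theta> \<tau> = ln (mcdf H (\<chi> i. 1 / \<tau> $ i)) / ln (mcdf Hhat (\<chi> i. 1 / \<tau> $ i))"
proof -
  have "0 < mcdf Hhat (\<chi> i. 1 / \<tau> $ i)"
    using assms by (intro Hhat_pos) simp
  \<comment> \<open>Any coordinate gives the strict bound; \<open>undefined\<close> merely names
    one.\<close>
  moreover have "mcdf Hhat (\<chi> i. 1 / \<tau> $ i) < 1"
    unfolding sub_mcdf_UNIV[symmetric] using assms by (intro Hhat_less_1[of undefined]) auto
  ultimately show ?thesis
    by (simp add: H_eq_powr[OF assms] ln_powr)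
qed

text \<open>In the formula of \<open>index_eq\<close> the coordinates outside \<open>A\<close> are
  \<open>1 / s $ i\<close> and tend to infinity, so \<open>sub_mcdf_limit\<close> applies to
  numerator and denominator. Nonemptiness of \<open>A\<close> keeps the limiting denominator
  nonzero.\<close>

lemma sub_index_eq:
  assumes \<tau>: "\<forall>i. 0 < \<tau> $ i" and "A \<noteq> {}"
  shows "sub_index \<theta> A \<tau> = ln (sub_mcdf H A (\<chi> i. 1 / \<tau> $ i)) / ln (sub_mcdf Hhat A (\<chi> i. 1 / \<tau> $ i))"
proof -
  let ?S = "{s :: real^'d. \<forall>i. 0 < s $ i}" and ?x = "\<chi> i. 1 / \<tau> $ i"
  define w where "w s = (\<chi> i. if i \<in> A then 1 / \<tau> $ i else 1 / s $ i)" for s :: "real^'d"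
  have pos: "0 < sub_mcdf G A ?x" if "G = H \<or> G = Hhat" for G
    using that \<tau> H Hhat H_pos[of ?x] Hhat_pos[of ?x] by (auto intro!: sub_mcdf_pos)
  have less_1: "sub_mcdf Hhat A ?x < 1"
  proof -
    obtain i where "i \<in> A" using \<open>A \<noteq> {}\<close> by blast
    then show ?thesis using \<tau> by (intro Hhat_less_1[of i]) auto
  qed
  have in_S: "\<forall>\<^sub>F s in at 0 within ?S. s \<in> ?S"
    by (simp add: eventually_at_filter)
  have lim: "((\<lambda>s. mcdf G (w s)) \<longlongrightarrow> sub_mcdf G A ?x) (at 0 within ?S)" if "prob_law G" for G
  proof (rule sub_mcdf_limit[OF that])
    fix i assume "i \<notin> A"
    \<comment> \<open>Within the positive orthant each coordinate approaches 0 from the right, so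
      its reciprocal tends to plus infinity.\<close>
    have "filterlim (\<lambda>s :: real^'d. s $ i) (at_right 0) (at 0 within ?S)"
      unfolding filterlim_at
    proof
      show "\<forall>\<^sub>F s in at 0 within ?S. s $ i \<in> {0<..} \<and> s $ i \<noteq> 0"
        by (rule eventually_mono[OF in_S]) (auto simp: less_imp_neq[symmetric])
      show "((\<lambda>s :: real^'d. s $ i) \<longlongrightarrow> 0) (at 0 within ?S)"
        using tendsto_vec_nth[OF tendsto_ident_at[of "0 :: real^'d" ?S], of i] by simp
    qed
    from filterlim_compose[OF filterlim_inverse_at_top_right this] \<open>i \<notin> A\<close>
    show "filterlim (\<lambda>s. w s $ i) at_top (at 0 within ?S)"
      by (simp add: w_def inverse_eq_divide)
  qed (simp add: w_def)
  have "((\<lambda>s. ln (mcdf H (w s)) / ln (mcdf Hhat (w s))) \<longlongrightarrow> ln (sub_mcdf H A ?x) / ln (sub_mcdf Hhat A ?x)) (at 0 within ?S)"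
    using pos[of H] pos[of Hhat] less_1 by (intro tendsto_intros lim H Hhat) auto
  moreover have "\<forall>\<^sub>F s in at 0 within ?S. ln (mcdf H (w s)) / ln (mcdf Hhat (w s)) = \<theta> (\<chi> i. if i \<in> A then \<tau> $ i else s $ i)"
    using in_S
  proof eventually_elim
    case (elim s)
    have "(\<chi> i. 1 / (\<chi> i. if i \<in> A then \<tau> $ i else s $ i) $ i) = w s"
      by (simp add: w_def vec_eq_iff)
    with elim \<tau> show ?case by (subst index_eq) auto
  qed
  ultimately have "((\<lambda>s. \<theta> (\<chi> i. if i \<in> A then \<tau> $ i else s $ i)) \<longlongrightarrow> ln (sub_mcdf H A ?x) / ln (sub_mcdf Hhat A ?x)) (at 0 within ?S)"
    by (rule Lim_transform_eventually)
  \<comment> \<open>\<open>Lim\<close> is determined by convergence only at a nontrivial filter, so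
    0 has to be a limit point of the positive orthant.\<close>
  moreover have "at (0 :: real^'d) within ?S \<noteq> bot"
  proof -
    have "\<exists>s\<in>?S. s \<noteq> 0 \<and> dist s 0 < e" if "0 < e" for e
    proof -
      \<comment> \<open>The positive multiple of the all-ones vector with norm
        \<open>e / 2\<close>.\<close>
      define s :: "real^'d" where "s = (e / (2 * norm (1 :: real^'d))) *\<^sub>R 1"
      have "norm s < e" using that by (simp add: s_def)
      moreover have "\<forall>i. 0 < s $ i" using that by (simp add: s_def)
      moreover from this have "s \<noteq> 0" by (metis less_irrefl zero_index)
      ultimately show ?thesis by auto
    qed
    then show ?thesis
      by (simp add: trivial_limit_within islimpt_approachable)
  qed
  ultimately show ?thesis
    unfolding sub_index_def by (intro tendsto_Lim)
qed

lemma exceed_lim_eq: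
  assumes "\<forall>i. 0 < \<tau> $ i"
  shows "exceed_lim M X u j j' (\<tau> $ j) (\<tau> $ j') = - ln (sub_mcdf Hhat {j, j'} (\<chi> i. 1 / \<tau> $ i))"
proof -
  have "\<P>(\<omega> in M. X 1 \<omega> $ j > u n j (\<tau> $ j) \<or> X 1 \<omega> $ j' > u n j' (\<tau> $ j'))
      = 1 - sub_mcdf F {j, j'} (\<chi> i. u n i (\<tau> $ i))" for n
    by (simp flip: prob_exceed)
  then show ?thesis
    unfolding exceed_lim_def using level_exceedance_limit[OF assms] by (simp add: limI)
qed

lemma pair_index_times_exceed_lim:
  assumes \<tau>: "\<forall>i. 0 < \<tau> $ i" and "j \<noteq> j'"
  shows "pair_index \<theta> j j' (\<tau> $ j) (\<tau> $ j') * exceed_lim M X u j j' (\<tau> $ j) (\<tau> $ j')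
    = - ln (sub_mcdf H {j, j'} (\<chi> i. 1 / \<tau> $ i))"
proof -
  \<comment> \<open>\<open>pair_index\<close> fills every coordinate other than \<open>j\<close>
    with its second argument. The \<open>{j, j'}\<close>-margin sees only the pair, and
    \<open>j \<noteq> j'\<close> puts \<open>\<tau> $ j'\<close> at \<open>j'\<close>.\<close>
  have "sub_mcdf G {j, j'} (\<chi> i. 1 / (\<chi> i. if i = j then \<tau> $ j else \<tau> $ j') $ i) = sub_mcdf G {j, j'} (\<chi> i. 1 / \<tau> $ i)" for G
    using \<open>j \<noteq> j'\<close> by (intro sub_mcdf_cong) auto
  moreover have "0 < sub_mcdf Hhat {j, j'} (\<chi> i. 1 / \<tau> $ i)" "sub_mcdf Hhat {j, j'} (\<chi> i. 1 / \<tau> $ i) < 1"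
    using \<tau> by (auto intro!: sub_mcdf_pos[OF Hhat] Hhat_pos Hhat_less_1[of j])
  ultimately show ?thesis
    unfolding pair_index_def exceed_lim_eq[OF \<tau>] using \<tau> by (subst sub_index_eq) auto
qed

text \<open>Solves \<open>sub_index_eq\<close> for the margin of \<open>H\<close>: at
  \<open>A = {i}\<close> the denominator is \<open>- 1 / s\<close> by the unit Frechet margin of
  \<open>Hhat\<close>.\<close>

lemma H_margin:
  assumes "0 < s" and "sub_index \<theta> {i} (\<chi> _. 1 / s) = c"
  shows "sub_mcdf H {i} (\<chi> _. s) = exp (- (c / s))"
proof -
  have "0 < sub_mcdf H {i} (\<chi> _. s)"
    using assms(1) by (intro sub_mcdf_pos[OF H] H_pos) simp
  moreover have "c = - s * ln (sub_mcdf H {i} (\<chi> _. s))"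
    using assms by (simp add: sub_index_eq Hhat_margin field_simps)
  then have "- (c / s) = ln (sub_mcdf H {i} (\<chi> _. s))"
    using assms(1) by simp
  ultimately show ?thesis by simp
qed

end

theorem proposition3p2:
  fixes M :: "'a measure"
    and X :: "nat \<Rightarrow> 'a \<Rightarrow> real^'d::{finite,linorder}"
    and u :: "nat \<Rightarrow> 'd::{finite,linorder} \<Rightarrow> real \<Rightarrow> real"
    and \<theta> :: "real^'d::{finite,linorder} \<Rightarrow> real"
    and \<theta>\<^sub>1 :: "'d::{finite,linorder} \<Rightarrow> real"
    and H Hhat :: "(real^'d::{finite,linorder}) measure"
    and j j' :: "'d::{finite,linorder}"
  assumes "prob_space M"
    and "stationary M X"
    and "\<And>i x. isCont (cdf (margin (distr M borel (X 1)) i)) x"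
    and "mev Hhat" and "unit_frechet_margins Hhat"
    and "\<And>x. (\<lambda>n. mcdf (distr M borel (X 1)) (real n *\<^sub>R x) ^ n) \<longlonglongrightarrow> mcdf Hhat x"
    and "mev H"
    and "\<And>x. (\<lambda>n. max_prob M X n (real n *\<^sub>R x)) \<longlonglongrightarrow> mcdf H x"
    and "has_multivariate_extremal_index M X u \<theta>"
    and "\<And>i. has_extremal_index M (\<lambda>n \<omega>. X n \<omega> $ i) (\<theta>\<^sub>1 i)"
    and "\<And>i t. t > 0 \<Longrightarrow> sub_index \<theta> {i} (\<chi> _. t) = \<theta>\<^sub>1 i"
    and "j < j'"
  shows "(tail_prob H j j' \<longlongrightarrow> tail_dep H j j') (at_left 1) \<and>
         (tail_prob Hhat j j' \<longlongrightarrow> tail_dep Hhat j j') (at_left 1) \<and>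
         tail_dep H j j' =
           2 - pair_index \<theta> j j' (1 / \<theta>\<^sub>1 j) (1 / \<theta>\<^sub>1 j') * exceed_lim M X u j j' (1 / \<theta>\<^sub>1 j) (1 / \<theta>\<^sub>1 j') \<and>
         tail_dep H j j' - tail_dep Hhat j j' =
           exceed_lim M X u j j' 1 1 -
           pair_index \<theta> j j' (1 / \<theta>\<^sub>1 j) (1 / \<theta>\<^sub>1 j') * exceed_lim M X u j j' (1 / \<theta>\<^sub>1 j) (1 / \<theta>\<^sub>1 j')"
proof -
  interpret prob_space M by fact
  have laws: "prob_law H" "prob_law Hhat"
    using assms(4,7) by (auto simp: mev_def)
  interpret extremal_index_setting M X u \<theta> H Hhat
    using assms laws by unfold_locales auto
  have \<theta>\<^sub>1: "0 < \<theta>\<^sub>1 i" for i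
    using assms(10)[of i] by (simp add: has_extremal_index_def)
  have H_margins: "sub_mcdf H {i} (\<chi> _. s) = exp (- (\<theta>\<^sub>1 i / s))" if "0 < s" for i s
    using that assms(11) by (intro H_margin) auto
  \<comment> \<open>The scales of the margins are \<open>\<theta>\<^sub>1\<close> for
    \<open>H\<close> and 1 for \<open>Hhat\<close>. They are the reciprocals of the arguments at
    which \<open>pair_index\<close> and \<open>exceed_lim\<close> are evaluated below.\<close>
  have tail_H: "(tail_prob H j j' \<longlongrightarrow> 2 + ln (sub_mcdf H {j, j'} (\<chi> i. \<theta>\<^sub>1 i))) (at_left 1)"
    by (rule tail_prob_tendsto[OF laws(1) \<theta>\<^sub>1 H_margins H_pos mev_max_stable[OF assms(7) H_pos H_margins]])
  have tail_Hhat: "(tail_prob Hhat j j' \<longlongrightarrow> 2 + ln (sub_mcdf Hhat {j, j'} (\<chi> i. 1))) (at_left 1)"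
    by (rule tail_prob_tendsto[OF laws(2) zero_less_one Hhat_margin Hhat_pos Hhat_stable])
  have dep: "tail_dep H j j' = 2 + ln (sub_mcdf H {j, j'} (\<chi> i. \<theta>\<^sub>1 i))"
    "tail_dep Hhat j j' = 2 + ln (sub_mcdf Hhat {j, j'} (\<chi> i. 1))"
    unfolding tail_dep_def using tail_H tail_Hhat by (auto intro!: tendsto_Lim)
  have "exceed_lim M X u j j' 1 1 = - ln (sub_mcdf Hhat {j, j'} (\<chi> i. 1))"
    using exceed_lim_eq[of "\<chi> _. 1" j j'] by simp
  moreover have "pair_index \<theta> j j' (1 / \<theta>\<^sub>1 j) (1 / \<theta>\<^sub>1 j') * exceed_lim M X u j j' (1 / \<theta>\<^sub>1 j) (1 / \<theta>\<^sub>1 j')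
      = - ln (sub_mcdf H {j, j'} (\<chi> i. \<theta>\<^sub>1 i))"
    using pair_index_times_exceed_lim[of "\<chi> i. 1 / \<theta>\<^sub>1 i" j j'] \<theta>\<^sub>1 assms(12) by simp
  ultimately show ?thesis
    using tail_H tail_Hhat by (simp add: dep)
qed

end
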